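(* Let $n\ge 3$, let $x_1,\dots,x_n$ be real numbers, and let $X_1,\dots,X_n$ be the successive values of a sample of size $n$ drawn sequentially without replacement from $\{x_1,\dots,x_n\}$. Put $S_k=X_1+\cdots+X_k$, $T_k=X_1^2+\cdots+X_k^2$, $M=S_n=\sum_{i=1}^n x_i$, $B=T_n=\sum_{i=1}^n x_i^2$, and $\mathcal{F}_k=\sigma(X_1,\dots,X_k)$. Then the process $$M_{1,k}=\frac{n(n-1)}{(n-k)(n-k-1)}S_k^2-\frac{2knM}{(n-k)(n-k-1)}S_k+\frac{kn}{(n-k)(n-k-1)}T_k+\frac{k(k+1)M^2-knB}{(n-k)(n-k-1)},\qquad 1\le k\le n-2,$$ is a martingale with respect to $\{\mathcal{F}_k:1\le k\le n-2\}$. In particular, if $M=0$, then $$\widetilde{M}_k=\frac{1}{(n-k)(n-k-1)}\left[(n-1)S_k^2-(B-T_k)k\right],\qquad 1\le k\le n-2,$$ is a martingale with respect to $\{\mathcal{F}_k:1\le k\le n-2\}$.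
   Context: Sampling without replacement: $X_i=x_{\sigma(i)}$ for $1\le i\le n$, where $\sigma$ is a uniformly distributed random permutation of $\{1,\dots,n\}$. The $x_i$ need not be distinct. *)

theory Defs
  imports "HOL-Probability.Probability" "HOL-Combinatorics.Permutations"
begin

definition uniform_random_permutation ::
    "'w measure \<Rightarrow> nat \<Rightarrow> ('w \<Rightarrow> nat \<Rightarrow> nat) \<Rightarrow> bool" where
  "uniform_random_permutation \<Omega> n \<sigma> \<longleftrightarrow>
     \<sigma> \<in> measurable \<Omega> (count_space {p. p permutes {1..n}}) \<and>
     distr \<Omega> (count_space {p. p permutes {1..n}}) \<sigma>
       = uniform_count_measure {p. p permutes {1..n}}"

text \<open>Only the space and the \<open>\<sigma>\<close>-algebra of this measure matter: its measure component
  is null, and conditional expectations use the restriction of \<open>\<Omega>\<close> to it.\<close>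

definition generated_filtration ::
    "'w measure \<Rightarrow> (nat \<Rightarrow> 'w \<Rightarrow> real) \<Rightarrow> nat \<Rightarrow> 'w measure" where
  "generated_filtration \<Omega> X k =
     sigma (space \<Omega>) (\<Union>i\<in>{1..k}. {X i -` A \<inter> space \<Omega> | A. A \<in> sets borel})"

definition filtration_on :: "'w measure \<Rightarrow> 'i::linorder set \<Rightarrow> ('i \<Rightarrow> 'w measure) \<Rightarrow> bool" where
  "filtration_on \<Omega> I F \<longleftrightarrow>
     (\<forall>i\<in>I. subalgebra \<Omega> (F i)) \<and>
     (\<forall>i\<in>I. \<forall>j\<in>I. i \<le> j \<longrightarrow> subalgebra (F j) (F i))"

definition martingale_on ::
    "'w measure \<Rightarrow> 'i::linorder set \<Rightarrow> ('i \<Rightarrow> 'w measure) \<Rightarrow> ('i \<Rightarrow> 'w \<Rightarrow> real) \<Rightarrow> bool" where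
  "martingale_on \<Omega> I F Y \<longleftrightarrow>
     filtration_on \<Omega> I F \<and>
     (\<forall>i\<in>I. Y i \<in> borel_measurable (F i)) \<and>
     (\<forall>i\<in>I. integrable \<Omega> (Y i)) \<and>
     (\<forall>i\<in>I. \<forall>j\<in>I. i \<le> j \<longrightarrow> (AE \<omega> in \<Omega>. real_cond_exp \<Omega> (F i) (Y j) \<omega> = Y i \<omega>))"

text \<open>A full sample has the totals of the population, so that \<open>S\<^sub>n = M\<close> (with \<open>f = x\<close>)
  and \<open>T\<^sub>n = B\<close> (with \<open>f i = (x i)\<^sup>2\<close>) hold pointwise.\<close>

lemma sum_full_sample:
  fixes f :: "nat \<Rightarrow> real"
  assumes "uniform_random_permutation \<Omega> n \<sigma>" and "\<omega> \<in> space \<Omega>"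
  shows "(\<Sum>i=1..n. f (\<sigma> \<omega> i)) = (\<Sum>i=1..n. f i)"
proof -
  have "\<sigma> \<omega> permutes {1..n}"
    using measurable_space[of \<sigma> \<Omega> "count_space {p. p permutes {1..n}}" \<omega>] assms
    unfolding uniform_random_permutation_def by simp
  then show ?thesis
    using sum.permute[of "\<sigma> \<omega>" "{1..n}" f] by (simp only: comp_def)
qed

end

theory Submission
  imports Defs
begin

text \<open>The law of \<open>\<sigma>\<close> is invariant under exchanging two positions beyond \<open>k\<close>, and such an
  exchange does not affect what happened up to time \<open>k\<close>. Hence, given the past, every later draw
  has the same conditional law as the next one, so that \<open>E[f (X\<^bsub>k+1\<^esub>) | F\<^sub>k]\<close> is the average of
  \<open>f\<close> over the values not yet drawn. With \<open>f\<close> the identity and the square this reduces the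
  martingale property of a combination \<open>a\<^sub>k S\<^sub>k\<^sup>2 + b\<^sub>k S\<^sub>k + c\<^sub>k T\<^sub>k + d\<^sub>k\<close> to a polynomial identity
  between consecutive coefficients.\<close>

subsection \<open>Uniform random permutations\<close>

text \<open>Precomposing with the swap of \<open>Suc k\<close> and \<open>j\<close> reindexes the
  set of permutations and leaves the weight \<open>g\<close> alone, so every position
  \<open>j\<close> beyond \<open>k\<close> contributes the same sum.\<close>

lemma sum_permutations_next_draw:
  fixes f :: "nat \<Rightarrow> real" and g :: "(nat \<Rightarrow> nat) \<Rightarrow> real"
  assumes "k < n" and g: "\<And>p q. (\<And>i. i \<in> {1..k} \<Longrightarrow> p i = q i) \<Longrightarrow> g p = g q"
  shows "(\<Sum>p | p permutes {1..n}. g p * f (p (Suc k))) =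
    (\<Sum>p | p permutes {1..n}. g p * (((\<Sum>i=1..n. f i) - (\<Sum>i=1..k. f (p i))) / (real n - real k)))"
proof -
  let ?P = "{p. p permutes {1..n}}"
  let ?L = "\<Sum>p\<in>?P. g p * f (p (Suc k))"
  let ?\<tau> = "Transposition.transpose (Suc k)"
  have swap: "(\<Sum>p\<in>?P. g p * f (p j)) = ?L" if "j \<in> {Suc k..n}" for j
  proof -
    have "?\<tau> j permutes {1..n}"
      using that assms(1) by (intro permutes_swap_id) auto
    then have "(\<Sum>p\<in>?P. g p * f (p j)) =
        (\<Sum>p\<in>?P. g (p \<circ> ?\<tau> j) * f ((p \<circ> ?\<tau> j) j))"
      by (rule sum_permutations_compose_right)
    also have "\<dots> = ?L"
    proof (rule sum.cong[OF refl])
      fix p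
      have "g (p \<circ> ?\<tau> j) = g p"
        using that by (intro g) (auto simp: Transposition.transpose_def)
      then show "g (p \<circ> ?\<tau> j) * f ((p \<circ> ?\<tau> j) j) = g p * f (p (Suc k))"
        by simp
    qed
    finally show ?thesis .
  qed
  \<comment> \<open>Adding up the n - k equal sums replaces a single draw by all draws after time
    \<open>k\<close>, whose total is the population total minus what has been drawn already.\<close>
  have "(real n - real k) * ?L = (\<Sum>j=Suc k..n. ?L)"
    using assms(1) by (simp add: of_nat_diff)
  also have "\<dots> = (\<Sum>j=Suc k..n. \<Sum>p\<in>?P. g p * f (p j))"
    by (rule sum.cong[OF refl swap[symmetric]])
  also have "\<dots> = (\<Sum>p\<in>?P. g p * (\<Sum>j=Suc k..n. f (p j)))"
    by (subst sum.swap) (simp add: sum_distrib_left)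
  also have "\<dots> = (\<Sum>p\<in>?P. g p * ((\<Sum>i=1..n. f i) - (\<Sum>i=1..k. f (p i))))"
  proof (rule sum.cong[OF refl])
    fix p assume "p \<in> ?P"
    then have "(\<Sum>i=1..n. f (p i)) = (\<Sum>i=1..n. f i)"
      using sum.permute[of p "{1..n}" f] by (simp add: comp_def)
    moreover have "(\<Sum>i=1..n. f (p i)) = (\<Sum>i=1..k. f (p i)) + (\<Sum>i=Suc k..n. f (p i))"
      using assms(1) sum.ub_add_nat[of 1 k "\<lambda>i. f (p i)" "n - k"] by simp
    ultimately show "g p * (\<Sum>j=Suc k..n. f (p j)) = g p * ((\<Sum>i=1..n. f i) - (\<Sum>i=1..k. f (p i)))"
      by simp
  qed
  finally have "(real n - real k) * ?L = \<dots>" .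
  then have "?L = (\<Sum>p\<in>?P. g p * ((\<Sum>i=1..n. f i) - (\<Sum>i=1..k. f (p i)))) / (real n - real k)"
    using assms(1) by (simp add: field_simps)
  then show ?thesis by (simp add: sum_divide_distrib)
qed

context
  fixes \<Omega> :: "'w measure" and n :: nat and \<sigma> :: "'w \<Rightarrow> nat \<Rightarrow> nat"
  assumes urp: "uniform_random_permutation \<Omega> n \<sigma>"
begin

text \<open>The law of \<open>\<sigma>\<close> lives on a finite set, where every function is
  integrable. Hence \<open>h\<close> is arbitrary and expectations become finite averages.\<close>

lemma
  fixes h :: "(nat \<Rightarrow> nat) \<Rightarrow> real"
  shows integrable_uniform_random_permutation: "integrable \<Omega> (\<lambda>\<omega>. h (\<sigma> \<omega>))"
    and integral_uniform_random_permutation: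
      "(\<integral>\<omega>. h (\<sigma> \<omega>) \<partial>\<Omega>) = (\<Sum>p | p permutes {1..n}. h p) / card {p. p permutes {1..n}}"
proof -
  let ?P = "{p. p permutes {1..n}}"
  have fin: "finite ?P" by (simp add: finite_permutations)
  have \<sigma>: "\<sigma> \<in> measurable \<Omega> (count_space ?P)"
    and distr: "distr \<Omega> (count_space ?P) \<sigma> = uniform_count_measure ?P"
    using urp unfolding uniform_random_permutation_def by auto
  have "integrable (uniform_count_measure ?P) h"
    unfolding uniform_count_measure_def by (intro integrable_point_measure_finite fin)
  then show "integrable \<Omega> (\<lambda>\<omega>. h (\<sigma> \<omega>))"
    unfolding distr[symmetric] by (rule integrable_distr[OF \<sigma>])
  have "(\<integral>\<omega>. h (\<sigma> \<omega>) \<partial>\<Omega>) = integral\<^sup>L (uniform_count_measure ?P) h"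
    unfolding distr[symmetric] by (rule integral_distr[OF \<sigma>, symmetric]) simp
  also have "\<dots> = sum h ?P / card ?P"
    by (rule integral_uniform_count_measure[OF fin])
  finally show "(\<integral>\<omega>. h (\<sigma> \<omega>) \<partial>\<Omega>) = sum h ?P / card ?P" .
qed

text \<open>As \<open>g\<close> ranges over the functions of the first \<open>k\<close> positions,
  this is the defining property of a conditional expectation. The conditioning is on the drawn
  indices, which determine the drawn values that generate the filtration.\<close>

lemma integral_next_draw:
  fixes f :: "nat \<Rightarrow> real" and g :: "(nat \<Rightarrow> nat) \<Rightarrow> real"
  assumes "k < n" and "\<And>p q. (\<And>i. i \<in> {1..k} \<Longrightarrow> p i = q i) \<Longrightarrow> g p = g q"
  shows "(\<integral>\<omega>. g (\<sigma> \<omega>) * f (\<sigma> \<omega> (Suc k)) \<partial>\<Omega>) =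
    (\<integral>\<omega>. g (\<sigma> \<omega>) * (((\<Sum>i=1..n. f i) - (\<Sum>i=1..k. f (\<sigma> \<omega> i))) / (real n - real k)) \<partial>\<Omega>)"
  using sum_permutations_next_draw[of k n g f, OF assms]
    integral_uniform_random_permutation[of "\<lambda>p. g p * f (p (Suc k))"]
    integral_uniform_random_permutation
      [of "\<lambda>p. g p * (((\<Sum>i=1..n. f i) - (\<Sum>i=1..k. f (p i))) / (real n - real k))"]
  by simp

lemma measurable_coordinate_permutation:
  fixes x :: "nat \<Rightarrow> real"
  shows "(\<lambda>\<omega>. x (\<sigma> \<omega> i)) \<in> borel_measurable \<Omega>"
  using borel_measurable_integrable[OF integrable_uniform_random_permutation[of "\<lambda>p. x (p i)"]] .

end

subsection \<open>The generated filtration\<close>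

lemma space_generated_filtration [simp]: "space (generated_filtration \<Omega> X k) = space \<Omega>"
  unfolding generated_filtration_def by (rule space_measure_of) auto

lemma sets_generated_filtration:
  "sets (generated_filtration \<Omega> X k) =
    sigma_sets (space \<Omega>) (\<Union>i\<in>{1..k}. {X i -` A \<inter> space \<Omega> | A. A \<in> sets borel})"
  unfolding generated_filtration_def by (rule sets_measure_of) auto

lemma measurable_generated_filtration:
  assumes "i \<in> {1..k}"
  shows "X i \<in> borel_measurable (generated_filtration \<Omega> X k)"
proof (rule measurableI)
  fix A :: "real set" assume "A \<in> sets borel"
  then show "X i -` A \<inter> space (generated_filtration \<Omega> X k) \<in> sets (generated_filtration \<Omega> X k)"
    using assms unfolding sets_generated_filtration space_generated_filtration
    by (intro sigma_sets.Basic UN_I) auto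
qed auto

lemma filtration_on_generated_filtration:
  assumes "\<And>i. X i \<in> borel_measurable \<Omega>"
  shows "filtration_on \<Omega> I (generated_filtration \<Omega> X)"
proof -
  have "sets (generated_filtration \<Omega> X k) \<subseteq> sets \<Omega>" for k
    unfolding sets_generated_filtration
    using assms by (intro sets.sigma_sets_subset) (auto intro: measurable_sets)
  moreover have "sets (generated_filtration \<Omega> X k) \<subseteq> sets (generated_filtration \<Omega> X l)" if "k \<le> l" for k l
    unfolding sets_generated_filtration using that by (intro sigma_sets_mono') (auto; force)
  ultimately show ?thesis
    by (auto simp: filtration_on_def subalgebra_def)
qed

text \<open>The sets that do not separate outcomes with equal observations up to time
  \<open>k\<close> include the generators and are closed under complements and countable unions.
  This allows the indicator of a past event to be written as a function of the permutation.\<close>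

lemma generated_filtration_determined:
  assumes "A \<in> sets (generated_filtration \<Omega> X k)" and "\<omega> \<in> space \<Omega>" and "\<omega>' \<in> space \<Omega>"
    and eq: "\<And>i. i \<in> {1..k} \<Longrightarrow> X i \<omega> = X i \<omega>'"
  shows "\<omega> \<in> A \<longleftrightarrow> \<omega>' \<in> A"
  using assms(1) unfolding sets_generated_filtration
proof (induction rule: sigma_sets.induct)
  case (Basic a)
  then show ?case using assms(2,3) eq by auto
next
  case (Compl a)
  then show ?case using assms(2,3) by blast
next
  case (Union a)
  then show ?case by blast
qed simp

text \<open>Conditional expectations are characterised by their integrals over the events of the
  conditioning algebra, so it suffices to compare these integrals at consecutive times and to
  iterate.\<close>

lemma martingale_on_generated_filtrationI:
  fixes X Y :: "nat \<Rightarrow> 'w \<Rightarrow> real"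
  assumes "finite_measure \<Omega>" and X: "\<And>i. X i \<in> borel_measurable \<Omega>"
    and adapted: "\<And>k. k \<in> {l..m} \<Longrightarrow> Y k \<in> borel_measurable (generated_filtration \<Omega> X k)"
    and int: "\<And>k. k \<in> {l..m} \<Longrightarrow> integrable \<Omega> (Y k)"
    and step: "\<And>k A. l \<le> k \<Longrightarrow> k < m \<Longrightarrow> A \<in> sets (generated_filtration \<Omega> X k) \<Longrightarrow>
      (\<integral>\<omega>\<in>A. Y (Suc k) \<omega> \<partial>\<Omega>) = (\<integral>\<omega>\<in>A. Y k \<omega> \<partial>\<Omega>)"
  shows "martingale_on \<Omega> {l..m} (generated_filtration \<Omega> X) Y"
proof -
  let ?F = "generated_filtration \<Omega> X"
  have filt: "filtration_on \<Omega> I ?F" for I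
    by (rule filtration_on_generated_filtration[OF X])
  have steps: "(\<integral>\<omega>\<in>A. Y j \<omega> \<partial>\<Omega>) = (\<integral>\<omega>\<in>A. Y i \<omega> \<partial>\<Omega>)"
    if "i \<le> j" "l \<le> i" "j \<le> m" "A \<in> sets (?F i)" for i j A
    using that
  proof (induction j rule: dec_induct)
    case (step k)
    \<comment> \<open>An event known at time \<open>i\<close> is still known at the later time
      \<open>k\<close>, so the one-step equality applies to it.\<close>
    have "A \<in> sets (?F k)"
      using filt[of UNIV] step by (auto simp: filtration_on_def subalgebra_def subset_iff)
    then have "(\<integral>\<omega>\<in>A. Y (Suc k) \<omega> \<partial>\<Omega>) = (\<integral>\<omega>\<in>A. Y k \<omega> \<partial>\<Omega>)"
      using step by (intro assms(5)) auto
    then show ?case using step by simp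
  qed simp
  have "AE \<omega> in \<Omega>. real_cond_exp \<Omega> (?F i) (Y j) \<omega> = Y i \<omega>"
    if "i \<in> {l..m}" "j \<in> {l..m}" "i \<le> j" for i j
  proof -
    \<comment> \<open>Finiteness makes the restriction of \<open>\<Omega>\<close> to
      \<open>?F i\<close> sigma-finite, as the characterisation of conditional expectations
      requires.\<close>
    interpret finite_measure_subalgebra \<Omega> "?F i"
      using assms(1) filt[of UNIV]
      by (simp add: finite_measure_subalgebra_def finite_measure_subalgebra_axioms_def filtration_on_def)
    show ?thesis
      using that by (intro real_cond_exp_charact steps adapted int) auto
  qed
  with filt adapted int show ?thesis
    by (simp add: martingale_on_def)
qed

subsection \<open>Quadratic martingales of sampling without replacement\<close>

text \<open>Given the past, the next draw has mean (M - s) / (n - k) and its square has mean (B - t)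
  / (n - k). The left side of \<open>coeffs\<close> is the process at time k + 1 with these means
  inserted; asking for it at all real \<open>s\<close> and \<open>t\<close> leaves pure algebra to
  check.\<close>

lemma quadratic_martingale:
  fixes \<Omega> :: "'w measure" and x :: "nat \<Rightarrow> real" and X S T :: "nat \<Rightarrow> 'w \<Rightarrow> real"
    and a b c d :: "nat \<Rightarrow> real"
  assumes "prob_space \<Omega>" and urp: "uniform_random_permutation \<Omega> n \<sigma>"
    and X: "\<And>i \<omega>. X i \<omega> = x (\<sigma> \<omega> i)"
    and S: "\<And>k \<omega>. S k \<omega> = (\<Sum>i=1..k. X i \<omega>)"
    and T: "\<And>k \<omega>. T k \<omega> = (\<Sum>i=1..k. (X i \<omega>)\<^sup>2)"
    and M: "M = (\<Sum>i=1..n. x i)" and B: "B = (\<Sum>i=1..n. (x i)\<^sup>2)"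
    and "m \<le> n"
    and coeffs: "\<And>k s t. l \<le> k \<Longrightarrow> k < m \<Longrightarrow>
      a (Suc k) * (s\<^sup>2 + 2 * s * ((M - s) / (real n - real k)) + (B - t) / (real n - real k))
      + b (Suc k) * (s + (M - s) / (real n - real k))
      + c (Suc k) * (t + (B - t) / (real n - real k)) + d (Suc k)
      = a k * s\<^sup>2 + b k * s + c k * t + d k"
  shows "martingale_on \<Omega> {l..m} (generated_filtration \<Omega> X)
    (\<lambda>k \<omega>. a k * (S k \<omega>)\<^sup>2 + b k * S k \<omega> + c k * T k \<omega> + d k)"
proof (rule martingale_on_generated_filtrationI)
  show "finite_measure \<Omega>" using assms(1) by (rule prob_space.finite_measure)
  show "X i \<in> borel_measurable \<Omega>" for i
    unfolding X[abs_def] by (rule measurable_coordinate_permutation[OF urp])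
  fix k
  show "(\<lambda>\<omega>. a k * (S k \<omega>)\<^sup>2 + b k * S k \<omega> + c k * T k \<omega> + d k)
      \<in> borel_measurable (generated_filtration \<Omega> X k)"
  proof -
    have [measurable]: "S k \<in> borel_measurable (generated_filtration \<Omega> X k)"
      "T k \<in> borel_measurable (generated_filtration \<Omega> X k)"
      unfolding S[abs_def] T[abs_def]
      by (intro borel_measurable_sum borel_measurable_power measurable_generated_filtration; assumption)+
    show ?thesis by measurable
  qed
  show "integrable \<Omega> (\<lambda>\<omega>. a k * (S k \<omega>)\<^sup>2 + b k * S k \<omega> + c k * T k \<omega> + d k)"
    unfolding S T X
    by (rule integrable_uniform_random_permutation[OF urp, of "\<lambda>p. a k * (\<Sum>i=1..k. x (p i))\<^sup>2
      + b k * (\<Sum>i=1..k. x (p i)) + c k * (\<Sum>i=1..k. (x (p i))\<^sup>2) + d k"])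
next
  fix k A assume k: "l \<le> k" "k < m" and A: "A \<in> sets (generated_filtration \<Omega> X k)"
  define s t where "s p = (\<Sum>i=1..k. x (p i))" and "t p = (\<Sum>i=1..k. (x (p i))\<^sup>2)" for p
  \<comment> \<open>\<open>u\<close> turns the indicator of \<open>A\<close> into a function of the
    permutation. It compares the values \<open>x (p i)\<close> and not the indices
    \<open>p i\<close>, because the population may have repeated values and the filtration sees only
    values.\<close>
  define u :: "(nat \<Rightarrow> nat) \<Rightarrow> real"
    where "u p = of_bool (\<exists>\<omega>\<in>A. \<forall>i\<in>{1..k}. x (p i) = x (\<sigma> \<omega> i))" for p
  have "A \<subseteq> space \<Omega>" using sets.sets_into_space[OF A] by simp
  have u: "indicator A \<omega> = u (\<sigma> \<omega>)" if "\<omega> \<in> space \<Omega>" for \<omega>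
  proof -
    have "\<omega> \<in> A" if "\<omega>' \<in> A" "\<forall>i\<in>{1..k}. x (\<sigma> \<omega> i) = x (\<sigma> \<omega>' i)" for \<omega>'
      using generated_filtration_determined[OF A \<open>\<omega> \<in> space \<Omega>\<close>, of \<omega>'] that \<open>A \<subseteq> space \<Omega>\<close>
      by (metis X subsetD)
    then have "(\<exists>\<omega>'\<in>A. \<forall>i\<in>{1..k}. x (\<sigma> \<omega> i) = x (\<sigma> \<omega>' i)) \<longleftrightarrow> \<omega> \<in> A"
      by blast
    then show ?thesis by (simp only: u_def indicator_def)
  qed
  have prefix: "s p = s q" "t p = t q" "u p = u q" if "\<And>i. i \<in> {1..k} \<Longrightarrow> p i = q i" for p q
    using that by (simp_all add: s_def t_def u_def)
  note int = integrable_uniform_random_permutation[OF urp]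
  define r where "r = real n - real k"
  \<comment> \<open>With y the next draw, the process at time k + 1 on \<open>A\<close> is expanded
    in powers of y, from (s + y)^2 = s^2 + 2 s y + y^2 and t + y^2. The coefficients
    \<open>?g0\<close>, \<open>?g1\<close>, \<open>?g2\<close> depend on the first \<open>k\<close>
    positions only.\<close>
  let ?g1 = "\<lambda>p. u p * (2 * a (Suc k) * s p + b (Suc k))"
  let ?g2 = "\<lambda>p. u p * (a (Suc k) + c (Suc k))"
  let ?g0 = "\<lambda>p. u p * (a (Suc k) * (s p)\<^sup>2 + b (Suc k) * s p + c (Suc k) * t p + d (Suc k))"
  have "k < n" using k \<open>m \<le> n\<close> by simp
  have g1: "(\<integral>\<omega>. ?g1 (\<sigma> \<omega>) * x (\<sigma> \<omega> (Suc k)) \<partial>\<Omega>) = (\<integral>\<omega>. ?g1 (\<sigma> \<omega>) * ((M - s (\<sigma> \<omega>)) / r) \<partial>\<Omega>)"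
    unfolding M r_def
  proof (rule integral_next_draw[OF urp \<open>k < n\<close>, of ?g1 x, folded s_def])
    show "?g1 p = ?g1 q" if "\<And>i. i \<in> {1..k} \<Longrightarrow> p i = q i" for p q
      using prefix(1,3)[OF that] by simp
  qed
  have g2: "(\<integral>\<omega>. ?g2 (\<sigma> \<omega>) * (x (\<sigma> \<omega> (Suc k)))\<^sup>2 \<partial>\<Omega>) = (\<integral>\<omega>. ?g2 (\<sigma> \<omega>) * ((B - t (\<sigma> \<omega>)) / r) \<partial>\<Omega>)"
    unfolding B r_def
  proof (rule integral_next_draw[OF urp \<open>k < n\<close>, of ?g2 "\<lambda>i. (x i)\<^sup>2", folded t_def])
    show "?g2 p = ?g2 q" if "\<And>i. i \<in> {1..k} \<Longrightarrow> p i = q i" for p q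
      using prefix(3)[OF that] by simp
  qed
  have "(\<integral>\<omega>\<in>A. a (Suc k) * (S (Suc k) \<omega>)\<^sup>2 + b (Suc k) * S (Suc k) \<omega> + c (Suc k) * T (Suc k) \<omega>
        + d (Suc k) \<partial>\<Omega>)
    = (\<integral>\<omega>. ?g0 (\<sigma> \<omega>) + ?g1 (\<sigma> \<omega>) * x (\<sigma> \<omega> (Suc k)) + ?g2 (\<sigma> \<omega>) * (x (\<sigma> \<omega> (Suc k)))\<^sup>2 \<partial>\<Omega>)"
    unfolding set_lebesgue_integral_def
    by (rule Bochner_Integration.integral_cong[OF refl])
       (simp add: u S T X s_def t_def power2_eq_square algebra_simps)
  also have "\<dots> = (\<integral>\<omega>. ?g0 (\<sigma> \<omega>) \<partial>\<Omega>) + (\<integral>\<omega>. ?g1 (\<sigma> \<omega>) * x (\<sigma> \<omega> (Suc k)) \<partial>\<Omega>)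
      + (\<integral>\<omega>. ?g2 (\<sigma> \<omega>) * (x (\<sigma> \<omega> (Suc k)))\<^sup>2 \<partial>\<Omega>)"
    using int[of ?g0] int[of "\<lambda>p. ?g1 p * x (p (Suc k))"] int[of "\<lambda>p. ?g2 p * (x (p (Suc k)))\<^sup>2"]
    by simp
  also have "\<dots> = (\<integral>\<omega>. ?g0 (\<sigma> \<omega>) + ?g1 (\<sigma> \<omega>) * ((M - s (\<sigma> \<omega>)) / r)
      + ?g2 (\<sigma> \<omega>) * ((B - t (\<sigma> \<omega>)) / r) \<partial>\<Omega>)"
    unfolding g1 g2
    using int[of ?g0] int[of "\<lambda>p. ?g1 p * ((M - s p) / r)"] int[of "\<lambda>p. ?g2 p * ((B - t p) / r)"]
    by simp
  also have "\<dots> = (\<integral>\<omega>\<in>A. a k * (S k \<omega>)\<^sup>2 + b k * S k \<omega> + c k * T k \<omega> + d k \<partial>\<Omega>)"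
    unfolding set_lebesgue_integral_def
  proof (rule Bochner_Integration.integral_cong[OF refl])
    fix \<omega> assume \<omega>: "\<omega> \<in> space \<Omega>"
    \<comment> \<open>\<open>y\<close> and \<open>z\<close> are independent variables here:
      \<open>z\<close> receives the mean of the squared draw, which is not the square of the
      mean.\<close>
    have expand: "?g0 p + ?g1 p * y + ?g2 p * z = u p * (a (Suc k) * ((s p)\<^sup>2 + 2 * s p * y + z)
        + b (Suc k) * (s p + y) + c (Suc k) * (t p + z) + d (Suc k))" for p y z
      by (simp add: algebra_simps)
    have ST: "S k \<omega> = s (\<sigma> \<omega>)" "T k \<omega> = t (\<sigma> \<omega>)"
      by (simp_all add: S T X s_def t_def)
    show "?g0 (\<sigma> \<omega>) + ?g1 (\<sigma> \<omega>) * ((M - s (\<sigma> \<omega>)) / r) + ?g2 (\<sigma> \<omega>) * ((B - t (\<sigma> \<omega>)) / r)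
      = indicator A \<omega> *\<^sub>R (a k * (S k \<omega>)\<^sup>2 + b k * S k \<omega> + c k * T k \<omega> + d k)"
      unfolding expand r_def coeffs[OF k] ST u[OF \<omega>] by simp
  qed
  finally show "(\<integral>\<omega>\<in>A. a (Suc k) * (S (Suc k) \<omega>)\<^sup>2 + b (Suc k) * S (Suc k) \<omega>
      + c (Suc k) * T (Suc k) \<omega> + d (Suc k) \<partial>\<Omega>)
    = (\<integral>\<omega>\<in>A. a k * (S k \<omega>)\<^sup>2 + b k * S k \<omega> + c k * T k \<omega> + d k \<partial>\<Omega>)" .
qed

text \<open>With r = n - k values left, the denominators are r, r (r - 1) and (r - 1) (r - 2). The
  hypothesis gives r > 2, so all can be cleared, and substituting n = k + r leaves a polynomial
  identity.\<close>

lemma first_coefficients_step: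
  fixes n k M B s t :: real
  assumes "k + 2 < n"
  shows "n * (n - 1) / ((n - (k+1)) * (n - (k+1) - 1)) * (s\<^sup>2 + 2 * s * ((M - s) / (n - k)) + (B - t) / (n - k))
    + - (2 * (k+1) * n * M / ((n - (k+1)) * (n - (k+1) - 1))) * (s + (M - s) / (n - k))
    + (k+1) * n / ((n - (k+1)) * (n - (k+1) - 1)) * (t + (B - t) / (n - k))
    + ((k+1) * ((k+1) + 1) * M\<^sup>2 - (k+1) * n * B) / ((n - (k+1)) * (n - (k+1) - 1))
   = n * (n - 1) / ((n - k) * (n - k - 1)) * s\<^sup>2 + - (2 * k * n * M / ((n - k) * (n - k - 1))) * s
    + k * n / ((n - k) * (n - k - 1)) * t + (k * (k + 1) * M\<^sup>2 - k * n * B) / ((n - k) * (n - k - 1))"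
proof -
  define r where "r = n - k"
  have n: "n = k + r" and e: "n - (k+1) = r - 1" "n - k = r" "r - 1 - 1 = r - 2" by (auto simp: r_def)
  have z: "r \<noteq> 0" "r - 1 \<noteq> 0" "r - 2 \<noteq> 0" using assms by (auto simp: r_def)
  show ?thesis unfolding e using z
    by (simp add: divide_simps) (unfold n, algebra)
qed

text \<open>For M = 0 these coefficients are the previous ones divided by n, and the same clearing
  of denominators works. The zero terms keep the shape demanded by
  \<open>quadratic_martingale\<close>.\<close>

lemma second_coefficients_step:
  fixes n k B s t :: real
  assumes "k + 2 < n"
  shows "(n - 1) / ((n - (k+1)) * (n - (k+1) - 1)) * (s\<^sup>2 + 2 * s * ((0 - s) / (n - k)) + (B - t) / (n - k))
    + 0 * (s + (0 - s) / (n - k))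
    + (k+1) / ((n - (k+1)) * (n - (k+1) - 1)) * (t + (B - t) / (n - k))
    + - (B * (k+1) / ((n - (k+1)) * (n - (k+1) - 1)))
   = (n - 1) / ((n - k) * (n - k - 1)) * s\<^sup>2 + 0 * s
    + k / ((n - k) * (n - k - 1)) * t + - (B * k / ((n - k) * (n - k - 1)))"
proof -
  define r where "r = n - k"
  have n: "n = k + r" and e: "n - (k+1) = r - 1" "n - k = r" "r - 1 - 1 = r - 2" by (auto simp: r_def)
  have z: "r \<noteq> 0" "r - 1 \<noteq> 0" "r - 2 \<noteq> 0" using assms by (auto simp: r_def)
  show ?thesis unfolding e using z
    by (simp add: divide_simps) (unfold n, algebra)
qed

theorem mainTheorem1:
  fixes \<Omega> :: "'w measure" and \<sigma> :: "'w \<Rightarrow> nat \<Rightarrow> nat"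
    and n :: nat and x :: "nat \<Rightarrow> real"
    and X S T :: "nat \<Rightarrow> 'w \<Rightarrow> real" and M B :: real
  assumes "prob_space \<Omega>"
    and "n \<ge> 3"
    and "uniform_random_permutation \<Omega> n \<sigma>"
    and X: "\<And>i \<omega>. X i \<omega> = x (\<sigma> \<omega> i)"
    and S: "\<And>k \<omega>. S k \<omega> = (\<Sum>i=1..k. X i \<omega>)"
    and T: "\<And>k \<omega>. T k \<omega> = (\<Sum>i=1..k. (X i \<omega>)\<^sup>2)"
    and M: "M = (\<Sum>i=1..n. x i)"
    and B: "B = (\<Sum>i=1..n. (x i)\<^sup>2)"
  shows "martingale_on \<Omega> {1..n-2} (generated_filtration \<Omega> X)
      (\<lambda>k \<omega>.
          real n * (real n - 1) / ((real n - real k) * (real n - real k - 1)) * (S k \<omega>)\<^sup>2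
        - 2 * real k * real n * M / ((real n - real k) * (real n - real k - 1)) * S k \<omega>
        + real k * real n / ((real n - real k) * (real n - real k - 1)) * T k \<omega>
        + (real k * (real k + 1) * M\<^sup>2 - real k * real n * B)
            / ((real n - real k) * (real n - real k - 1)))
    \<and> (M = 0 \<longrightarrow>
        martingale_on \<Omega> {1..n-2} (generated_filtration \<Omega> X)
          (\<lambda>k \<omega>. 1 / ((real n - real k) * (real n - real k - 1))
            * ((real n - 1) * (S k \<omega>)\<^sup>2 - (B - T k \<omega>) * real k)))"
proof -
  note criterion = quadratic_martingale[OF assms(1,3) X S T M B, where m = "n - 2" and l = 1]
  let ?D = "\<lambda>k. (real n - real k) * (real n - real k - 1)"
  have Suc: "real (Suc k) = real k + 1" for k by simp
  have "martingale_on \<Omega> {1..n-2} (generated_filtration \<Omega> X)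
      (\<lambda>k \<omega>. real n * (real n - 1) / ?D k * (S k \<omega>)\<^sup>2
        + - (2 * real k * real n * M / ?D k) * S k \<omega>
        + real k * real n / ?D k * T k \<omega>
        + (real k * (real k + 1) * M\<^sup>2 - real k * real n * B) / ?D k)"
    \<comment> \<open>Steps start at k < n - 2, that is k + 2 < n, which keeps the denominators at k
      + 1 nonzero too.\<close>
    by (rule criterion, simp, unfold Suc, rule first_coefficients_step, linarith)
  then have first: "martingale_on \<Omega> {1..n-2} (generated_filtration \<Omega> X)
      (\<lambda>k \<omega>. real n * (real n - 1) / ?D k * (S k \<omega>)\<^sup>2
        - 2 * real k * real n * M / ?D k * S k \<omega>
        + real k * real n / ?D k * T k \<omega>
        + (real k * (real k + 1) * M\<^sup>2 - real k * real n * B) / ?D k)"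
    by (simp only: mult_minus_left add_uminus_conv_diff)
  have second: "martingale_on \<Omega> {1..n-2} (generated_filtration \<Omega> X)
      (\<lambda>k \<omega>. (real n - 1) / ?D k * (S k \<omega>)\<^sup>2 + 0 * S k \<omega>
        + real k / ?D k * T k \<omega> + - (B * real k / ?D k))" if "M = 0"
    by (rule criterion, simp, unfold Suc \<open>M = 0\<close>, rule second_coefficients_step, linarith)
  \<comment> \<open>This holds for every \<open>D\<close>, including 0 where both sides vanish, so
    it can rewrite the process under the binder for all \<open>k\<close> at once.\<close>
  have "(real n - 1) / D * s\<^sup>2 + 0 * s + real k / D * t + - (B * real k / D)
      = 1 / D * ((real n - 1) * s\<^sup>2 - (B - t) * real k)" for D s t k
    by (simp add: diff_divide_distrib add_divide_distrib algebra_simps)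
  with second have "martingale_on \<Omega> {1..n-2} (generated_filtration \<Omega> X)
      (\<lambda>k \<omega>. 1 / ?D k * ((real n - 1) * (S k \<omega>)\<^sup>2 - (B - T k \<omega>) * real k))" if "M = 0"
    using that by (simp only:)
  with first show ?thesis by blast
qed

end
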